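(* Let $M\ge2$ be an integer and $M^{-2}<p<M^{-1}$. Let $E$ be the planar fractal percolation with parameters $M,p$. Fix $\varepsilon$ with $0<\varepsilon<\min\{p,\tfrac1{10}\}$ and $Mp(1+\varepsilon)<1$, and set $$r:=\frac{\sqrt2\,p^2\varepsilon^2}{9},\qquad C_2:=\frac{8M\log M}{r}+1 .$$ Then for almost all realizations of $E$: $$\forall\,\theta\in\left(0,\tfrac{\pi}{4}\right)\ \exists N\ \forall n\ge N\ \forall \ell\in\mathfrak{L}^\theta:\qquad \#\mathcal{E}_n(\ell)\le 6C_2\,n .$$
   Context: Planar fractal percolation with parameters $M,p$: the closed unit square $K=[0,1]^2$ is divided into $M^2$ congruent closed squares of side $M^{-1}$; each is retained with probability $p$ and discarded with probability $1-p$, independently; in each retained square the division and independent retaining/discarding is repeated, ad infinitum. $E_n$ is the union of the retained level-$n$ squares (side $M^{-n}$), and $E=\bigcap_n E_n$. $\Delta$ is the decreasing diagonal of $K$ (joining $(0,1)$ and $(1,0)$). $\mathfrak{L}$ is the set of all line segments $\ell=K\cap L$, where $L$ is a line that makes an angle $\mathrm{Arg}(L)\in(0,\pi/2)$ with the $x$-axis and meets the relative interior of $\Delta$; put $\mathrm{Arg}(\ell)=\mathrm{Arg}(L)$. For $0<\theta<\pi/4$, $\mathfrak{L}^\theta:=\{\ell\in\mathfrak{L}:\min\{\mathrm{Arg}(\ell),\pi/2-\mathrm{Arg}(\ell)\}>\theta\}$. $\mathcal{E}_n(\ell)$ is the collection of retained level-$n$ squares whose interior intersects $\ell$. *)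

theory Defs
  imports "HOL-Probability.Probability"
begin

section \<open>Planar fractal percolation\<close>

text \<open>
  A triple \<open>(n, i, j)\<close> with \<open>i, j < M ^ n\<close> stands for the square of level \<open>n\<close> with
  lower left corner \<open>(i / M ^ n, j / M ^ n)\<close>; its parent is \<open>(n - 1, i div M, j div M)\<close>.
\<close>

definition level_square :: "nat \<Rightarrow> nat \<Rightarrow> nat \<times> nat \<Rightarrow> (real \<times> real) set" where
  "level_square M n = (\<lambda>(i, j).
     {real i / real M ^ n .. real (i + 1) / real M ^ n} \<times>
     {real j / real M ^ n .. real (j + 1) / real M ^ n})"

definition square_indices :: "nat \<Rightarrow> (nat \<times> nat \<times> nat) set" where
  "square_indices M = {(n, i, j). 1 \<le> n \<and> i < M ^ n \<and> j < M ^ n}"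

text \<open>
  Every square of level at least one carries its own coin \<open>X (n, i, j)\<close>, tossed independently
  and showing \<open>True\<close> with probability \<open>p\<close>. Coins of squares with a discarded ancestor are
  never looked at, see \<open>retained_indices\<close>.
\<close>

locale fractal_percolation = prob_space P
  for P :: "'a measure" +
  fixes M :: nat and p :: real and X :: "nat \<times> nat \<times> nat \<Rightarrow> 'a \<Rightarrow> bool"
  assumes indep: "indep_vars (\<lambda>_. count_space UNIV) X (square_indices M)"
    and prob_retain: "\<And>s. s \<in> square_indices M \<Longrightarrow> prob {\<omega> \<in> space P. X s \<omega>} = p"

primrec retained_indices ::
    "nat \<Rightarrow> (nat \<times> nat \<times> nat \<Rightarrow> 'a \<Rightarrow> bool) \<Rightarrow> 'a \<Rightarrow> nat \<Rightarrow> (nat \<times> nat) set" where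
  "retained_indices M X \<omega> 0 = {(0, 0)}"
| "retained_indices M X \<omega> (Suc n) =
     {(i, j). (i div M, j div M) \<in> retained_indices M X \<omega> n \<and> X (Suc n, i, j) \<omega>}"

definition retained_squares ::
    "nat \<Rightarrow> (nat \<times> nat \<times> nat \<Rightarrow> 'a \<Rightarrow> bool) \<Rightarrow> 'a \<Rightarrow> nat \<Rightarrow> (real \<times> real) set set" where
  "retained_squares M X \<omega> n = level_square M n ` retained_indices M X \<omega> n"

definition percolation_level ::
    "nat \<Rightarrow> (nat \<times> nat \<times> nat \<Rightarrow> 'a \<Rightarrow> bool) \<Rightarrow> 'a \<Rightarrow> nat \<Rightarrow> (real \<times> real) set" where
  "percolation_level M X \<omega> n = \<Union> (retained_squares M X \<omega> n)"

definition percolation_set ::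
    "nat \<Rightarrow> (nat \<times> nat \<times> nat \<Rightarrow> 'a \<Rightarrow> bool) \<Rightarrow> 'a \<Rightarrow> (real \<times> real) set" where
  "percolation_set M X \<omega> = (\<Inter>n. percolation_level M X \<omega> n)"

definition retained_squares_meeting ::
    "nat \<Rightarrow> (nat \<times> nat \<times> nat \<Rightarrow> 'a \<Rightarrow> bool) \<Rightarrow> 'a \<Rightarrow> nat \<Rightarrow> (real \<times> real) set
      \<Rightarrow> (real \<times> real) set set" where
  "retained_squares_meeting M X \<omega> n l =
     {Q \<in> retained_squares M X \<omega> n. interior Q \<inter> l \<noteq> {}}"

lemma retained_indices_bound:
  assumes "M \<ge> 1" "(i, j) \<in> retained_indices M X \<omega> n"
  shows "i < M ^ n \<and> j < M ^ n"
  using assms(2)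
proof (induction n arbitrary: i j)
  case (Suc n)
  then have "i div M < M ^ n" "j div M < M ^ n" by auto
  with \<open>M \<ge> 1\<close> show ?case by (simp add: div_less_iff_less_mult mult.commute)
qed simp

lemma finite_retained_squares_meeting:
  assumes "M \<ge> 1"
  shows "finite (retained_squares_meeting M X \<omega> n l)"
proof -
  have "retained_indices M X \<omega> n \<subseteq> {..<M ^ n} \<times> {..<M ^ n}"
    using retained_indices_bound[OF assms] by fastforce
  then have "finite (retained_indices M X \<omega> n)"
    by (rule finite_subset) simp
  then show ?thesis
    by (simp add: retained_squares_meeting_def retained_squares_def)
qed

section \<open>Line segments in the unit square\<close>

definition unit_square :: "(real \<times> real) set" where
  "unit_square = {0..1} \<times> {0..1}"

definition decreasing_diagonal :: "(real \<times> real) set" where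
  "decreasing_diagonal = closed_segment (0, 1) (1, 0)"

definition line_with_angle :: "(real \<times> real) set \<Rightarrow> real \<Rightarrow> bool" where
  "line_with_angle L \<alpha> \<longleftrightarrow> (\<exists>a. L = range (\<lambda>t::real. a + t *\<^sub>R (cos \<alpha>, sin \<alpha>)))"

definition diagonal_line :: "(real \<times> real) set \<Rightarrow> real \<Rightarrow> bool" where
  "diagonal_line L \<alpha> \<longleftrightarrow> 0 < \<alpha> \<and> \<alpha> < pi / 2 \<and> line_with_angle L \<alpha>
     \<and> L \<inter> rel_interior decreasing_diagonal \<noteq> {}"

definition segments :: "(real \<times> real) set set" where
  "segments = {l. \<exists>L \<alpha>. diagonal_line L \<alpha> \<and> l = unit_square \<inter> L}"

definition segment_angle :: "(real \<times> real) set \<Rightarrow> real" where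
  "segment_angle l = (THE \<alpha>. \<exists>L. diagonal_line L \<alpha> \<and> l = unit_square \<inter> L)"

definition segments_above :: "real \<Rightarrow> (real \<times> real) set set" where
  "segments_above \<theta> =
     {l \<in> segments. min (segment_angle l) (pi / 2 - segment_angle l) > \<theta>}"

text \<open>The angle of a segment does not depend on the line that cuts it out.\<close>

lemma line_with_angle_through:
  assumes "line_with_angle L \<alpha>" "c \<in> L"
  shows "L = range (\<lambda>t::real. c + t *\<^sub>R (cos \<alpha>, sin \<alpha>))"
proof -
  obtain a where L: "L = range (\<lambda>t::real. a + t *\<^sub>R (cos \<alpha>, sin \<alpha>))"
    using assms(1) by (auto simp: line_with_angle_def)
  obtain s where c: "c = a + s *\<^sub>R (cos \<alpha>, sin \<alpha>)"
    using assms(2) L by auto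
  have "a + t *\<^sub>R (cos \<alpha>, sin \<alpha>) = c + (t - s) *\<^sub>R (cos \<alpha>, sin \<alpha>)" for t
    by (simp add: c algebra_simps)
  moreover have "c + t *\<^sub>R (cos \<alpha>, sin \<alpha>) = a + (s + t) *\<^sub>R (cos \<alpha>, sin \<alpha>)" for t
    by (simp add: c algebra_simps)
  ultimately show ?thesis
    unfolding L by (metis (mono_tags, lifting) image_subset_iff rangeI subset_antisym)
qed

lemma diagonal_line_angle_unique:
  assumes "diagonal_line L \<alpha>" "diagonal_line L' \<beta>" "unit_square \<inter> L = unit_square \<inter> L'"
  shows "\<alpha> = \<beta>"
proof -
  obtain c where c: "c \<in> L" "c \<in> rel_interior decreasing_diagonal"
    using assms(1) by (auto simp: diagonal_line_def)
  have "c \<in> open_segment (0, 1) (1, 0)"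
    using c(2) by (simp add: decreasing_diagonal_def rel_interior_closed_segment)
  then obtain u where u: "0 < u" "u < 1" "c = (u, 1 - u)"
    by (auto simp: in_segment)
  define t where "t = min (1 - u) u"
  have t: "0 < t" "t \<le> 1 - u" "t \<le> u" using u by (auto simp: t_def)
  have ang: "0 < cos \<alpha>" "0 < sin \<alpha>" "0 < cos \<beta>" "0 < \<alpha>" "\<alpha> < pi" "0 < \<beta>" "\<beta> < pi"
    using assms(1,2) by (auto simp: diagonal_line_def cos_gt_zero sin_gt_zero)
  have bounds: "0 \<le> t * cos \<alpha>" "t * cos \<alpha> \<le> t" "0 \<le> t * sin \<alpha>" "t * sin \<alpha> \<le> t"
    using t ang by (auto simp: mult_left_le)
  define d where "d = c + t *\<^sub>R (cos \<alpha>, sin \<alpha>)"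
  have "c \<in> unit_square" using u by (simp add: unit_square_def)
  then have "c \<in> L'" using c(1) assms(3) by blast
  have "d \<in> L"
    using line_with_angle_through[of L \<alpha> c] assms(1) c(1) by (auto simp: diagonal_line_def d_def)
  moreover have "d \<in> unit_square"
  proof -
    have "u + t * cos \<alpha> \<le> 1" "t * sin \<alpha> \<le> u" using bounds t by linarith+
    moreover have "0 \<le> u + t * cos \<alpha>" "0 \<le> 1 - u + t * sin \<alpha>" using bounds u by linarith+
    ultimately show ?thesis by (simp add: d_def u(3) unit_square_def)
  qed
  ultimately have "d \<in> L'" using assms(3) by blast
  then obtain s where s: "d = c + s *\<^sub>R (cos \<beta>, sin \<beta>)"
    using line_with_angle_through[of L' \<beta> c] assms(2) \<open>c \<in> L'\<close> by (auto simp: diagonal_line_def)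
  have eq: "t * cos \<alpha> = s * cos \<beta>" "t * sin \<alpha> = s * sin \<beta>"
    using s by (auto simp: d_def)
  have "t\<^sup>2 = (t * cos \<alpha>)\<^sup>2 + (t * sin \<alpha>)\<^sup>2"
    by (simp add: power_mult_distrib flip: distrib_left)
  also have "\<dots> = s\<^sup>2"
    by (simp add: eq power_mult_distrib flip: distrib_left)
  finally have "t\<^sup>2 = s\<^sup>2" .
  moreover have "0 < s" using eq(1) t(1) ang by (metis mult_pos_pos zero_less_mult_pos2)
  ultimately have "t = s" using t(1) by simp
  with eq(1) t(1) have "cos \<alpha> = cos \<beta>" by simp
  with ang show ?thesis by (simp add: cos_inj_pi)
qed

lemma segment_angle_eq:
  assumes "diagonal_line L \<alpha>"
  shows "segment_angle (unit_square \<inter> L) = \<alpha>"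
  unfolding segment_angle_def
  using assms diagonal_line_angle_unique by (intro the_equality) blast+

end

(* Fix a level N and a set G of level-N cells with at most one cell in each column (or in each
   row). Give a square of level n the weight M^(n-N) times the number of cells of G it contains.
   Weights lie in [0,1] and the weights of the children of a square add up to M times its own
   weight. Since e^(eps*y) - 1 <= eps*y*(1+eps) on [0,1] and M*p*(1+eps) <= 1, the exponential
   of eps times the total weight of the retained squares is a supermartingale. So the number of
   retained cells of G has exponential moment at most e^eps, uniformly in N and G.

   At level n, the squares that meet a line are covered by four digital lines from a family of
   O(M^(2n)) such sets G. A union bound and Borel-Cantelli then give at most 4 * (3/eps) n log M
   retained squares on every line, eventually, which is far below 6 C2 n. *)

theory Submission
  imports Defs
begin

section \<open>Subdivision of index sets\<close>

definition children :: "nat \<Rightarrow> (nat \<times> nat) set \<Rightarrow> (nat \<times> nat) set" where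
  "children M S = {(i, j). (i div M, j div M) \<in> S}"

lemma children_eq_UN: "children M S = (\<Union>Q\<in>S. children M {Q})"
  by (auto simp: children_def)

lemma finite_children:
  assumes "finite S" "M \<ge> 1"
  shows "finite (children M S)"
proof -
  have "finite (children M {Q})" for Q
  proof (rule finite_subset)
    show "children M {Q} \<subseteq> {..<(fst Q + 1) * M} \<times> {..<(snd Q + 1) * M}"
      using \<open>M \<ge> 1\<close> by (auto simp: children_def dividend_less_div_times)
  qed simp
  with assms(1) show ?thesis
    by (subst children_eq_UN) simp
qed

text \<open>A square has only one parent, so the families of children of distinct squares are
  disjoint.\<close>

lemma sum_children:
  assumes "finite S" "M \<ge> 1"
  shows "sum f (children M S) = (\<Sum>Q\<in>S. sum f (children M {Q}))"
  using assms
  by (subst children_eq_UN, subst sum.UNION_disjoint) (auto simp: finite_children, auto simp: children_def)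

lemma retained_indices_Suc:
  "retained_indices M X \<omega> (Suc n) = {Q \<in> children M (retained_indices M X \<omega> n). X (Suc n, Q) \<omega>}"
  by (auto simp: children_def)

lemma retained_indices_in_Pow:
  assumes "M \<ge> 1"
  shows "retained_indices M X \<omega> n \<in> Pow ({..<M ^ n} \<times> {..<M ^ n})"
  using retained_indices_bound[OF assms] by fastforce

lemma finite_retained_indices: "M \<ge> 1 \<Longrightarrow> finite (retained_indices M X \<omega> n)"
  by (rule finite_subset[OF PowD[OF retained_indices_in_Pow]]) auto

text \<open>A square of level \<open>Suc n\<close> whose parent is retained has its index in
  \<open>square_indices M\<close>, so only coins of levels up to \<open>n\<close> inside the unit
  square are consulted. \<open>X\<close> and \<open>Y\<close> may live on different sample spaces;
  this lets \<open>retained_indices\<close> be read as a function of a finite coin vector.\<close>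

lemma retained_indices_cong:
  assumes "M \<ge> 1" "\<And>s. s \<in> square_indices M \<Longrightarrow> fst s \<le> n \<Longrightarrow> X s \<omega> = Y s \<omega>'"
  shows "retained_indices M X \<omega> n = retained_indices M Y \<omega>' n"
  using assms(2)
proof (induction n)
  case (Suc n)
  then have IH: "retained_indices M X \<omega> n = retained_indices M Y \<omega>' n"
    by simp
  have "X (Suc n, i, j) \<omega> = Y (Suc n, i, j) \<omega>'"
    if "(i div M, j div M) \<in> retained_indices M Y \<omega>' n" for i j
  proof -
    have "i < M ^ Suc n" "j < M ^ Suc n"
      using retained_indices_bound[OF \<open>M \<ge> 1\<close> that] \<open>M \<ge> 1\<close>
      by (auto simp: div_less_iff_less_mult mult.commute)
    then show ?thesis
      using Suc.prems[of "(Suc n, i, j)"] by (simp add: square_indices_def)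
  qed
  with IH show ?case by auto
qed simp

text \<open>Start from \<open>exp t \<le> 1 + t + t\<^sup>2\<close> on the unit interval with
  \<open>t = l * y\<close>; as \<open>y \<le> 1\<close>, the quadratic term is at most
  \<open>l * y * l\<close>.\<close>

lemma exp_le_linear:
  fixes l y :: real
  assumes "0 \<le> l" "l \<le> 1" "0 \<le> y" "y \<le> 1"
  shows "exp (l * y) - 1 \<le> l * y * (1 + l)"
proof -
  have "0 \<le> l * y" "l * y \<le> 1"
    using assms by (auto simp: mult_le_one)
  then have "exp (l * y) \<le> 1 + l * y + (l * y)\<^sup>2"
    by (rule exp_bound)
  also have "(l * y)\<^sup>2 \<le> l * y * l"
    using assms by (simp add: power2_eq_square mult_left_le mult_left_mono)
  finally show ?thesis by (simp add: algebra_simps)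
qed

section \<open>Measurability and independence of the coins\<close>

context fractal_percolation
begin

lemma p_bounds:
  assumes "M \<ge> 1"
  shows "0 \<le> p" "p \<le> 1"
proof -
  have "p = prob {\<omega> \<in> space P. X (1, 0, 0) \<omega>}"
    using assms by (intro prob_retain[symmetric]) (simp add: square_indices_def)
  then show "0 \<le> p" "p \<le> 1" by auto
qed

lemma finite_square_indices_upto: "finite {s \<in> square_indices M. fst s \<le> n}"
proof (rule finite_subset)
  show "{s \<in> square_indices M. fst s \<le> n} \<subseteq> (SIGMA m:{..n}. {..<M ^ m} \<times> {..<M ^ m})"
    by (auto simp: square_indices_def)
qed simp

text \<open>The sigma-algebra of finitely many coins is discrete, so every function of such a coin
  vector is measurable.\<close>

lemma PiM_coins:
  assumes "finite A"
  shows "Pi\<^sub>M A (\<lambda>_. count_space (UNIV :: bool set)) = count_space (A \<rightarrow>\<^sub>E UNIV)"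
  using assms by (intro count_space_PiM_finite) auto

lemma indep_var_finite_coins:
  assumes "finite A" "finite B" "A \<inter> B = {}" "A \<subseteq> square_indices M" "B \<subseteq> square_indices M"
    and "f \<in> (A \<rightarrow>\<^sub>E UNIV) \<rightarrow> space N" "g \<in> (B \<rightarrow>\<^sub>E UNIV) \<rightarrow> space N'"
  shows "indep_var N (\<lambda>\<omega>. f (restrict (\<lambda>s. X s \<omega>) A)) N' (\<lambda>\<omega>. g (restrict (\<lambda>s. X s \<omega>) B))"
proof -
  have "indep_var (count_space (A \<rightarrow>\<^sub>E UNIV)) (\<lambda>\<omega>. restrict (\<lambda>s. X s \<omega>) A)
      (count_space (B \<rightarrow>\<^sub>E UNIV)) (\<lambda>\<omega>. restrict (\<lambda>s. X s \<omega>) B)"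
    using indep_var_restrict[OF indep assms(3-5)] assms(1,2) by (simp add: PiM_coins)
  from indep_var_compose[OF this, of f N g N'] assms(6,7) show ?thesis
    by (simp add: o_def)
qed

lemma random_variable_coin:
  "s \<in> square_indices M \<Longrightarrow> X s \<in> measurable P (count_space UNIV)"
  using indep by (auto simp: indep_vars_def)

text \<open>The sample point on the right is the finite coin vector itself, with the coordinate maps
  \<open>\<lambda>s c. c s\<close> as coins. Measurability and independence of the retained set are
  both derived from this form.\<close>

lemma retained_indices_eq_restrict:
  assumes "M \<ge> 1"
  shows "retained_indices M X \<omega> n =
    retained_indices M (\<lambda>s c. c s) (restrict (\<lambda>s. X s \<omega>) {s \<in> square_indices M. fst s \<le> n}) n"
  by (rule retained_indices_cong[OF assms]) simp

lemma measurable_retained_indices: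
  assumes "M \<ge> 1"
  shows "(\<lambda>\<omega>. retained_indices M X \<omega> n) \<in> measurable P (count_space UNIV)"
proof -
  let ?A = "{s \<in> square_indices M. fst s \<le> n}"
  have "(\<lambda>\<omega>. restrict (\<lambda>s. X s \<omega>) ?A) \<in> measurable P (Pi\<^sub>M ?A (\<lambda>_. count_space UNIV))"
    by (intro measurable_restrict random_variable_coin) auto
  then have "(\<lambda>\<omega>. restrict (\<lambda>s. X s \<omega>) ?A) \<in> measurable P (count_space (?A \<rightarrow>\<^sub>E UNIV))"
    by (simp add: PiM_coins finite_square_indices_upto)
  then have "(\<lambda>\<omega>. retained_indices M (\<lambda>s c. c s) (restrict (\<lambda>s. X s \<omega>) ?A) n)
      \<in> measurable P (count_space UNIV)"
    by (rule measurable_compose) simp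
  then show ?thesis
    using retained_indices_eq_restrict[OF assms] by simp
qed

lemma expectation_prod_coins:
  fixes g :: "nat \<times> nat \<times> nat \<Rightarrow> bool \<Rightarrow> real"
  assumes "finite C" "C \<subseteq> square_indices M"
  shows "expectation (\<lambda>\<omega>. \<Prod>s\<in>C. g s (X s \<omega>)) = (\<Prod>s\<in>C. p * g s True + (1 - p) * g s False)"
proof -
  have single: "integrable P (\<lambda>\<omega>. g s (X s \<omega>))"
      "expectation (\<lambda>\<omega>. g s (X s \<omega>)) = p * g s True + (1 - p) * g s False"
    if "s \<in> C" for s
  proof -
    have s: "s \<in> square_indices M" using that assms(2) by auto
    note [measurable] = random_variable_coin[OF s]
    let ?A = "{\<omega> \<in> space P. X s \<omega>}"
    have [simp]: "integrable P (indicat_real ?A)"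
      by (intro integrable_real_indicator) (auto simp: emeasure_eq_measure)
    \<comment> \<open>A coin has two values, so any function of it is affine in the indicator of
      \<open>True\<close>.\<close>
    have "integrable P (\<lambda>\<omega>. g s False + (g s True - g s False) * indicator ?A \<omega>)"
      by simp
    moreover have eq: "g s (X s \<omega>) = g s False + (g s True - g s False) * indicator ?A \<omega>"
      if "\<omega> \<in> space P" for \<omega>
      using that by (cases "X s \<omega>") (auto simp: indicator_def)
    ultimately show "integrable P (\<lambda>\<omega>. g s (X s \<omega>))"
      by (subst Bochner_Integration.integrable_cong[OF refl eq]) auto
    have "expectation (\<lambda>\<omega>. g s (X s \<omega>))
        = expectation (\<lambda>\<omega>. g s False + (g s True - g s False) * indicator ?A \<omega>)"
      by (intro Bochner_Integration.integral_cong refl eq)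
    also have "\<dots> = g s False + (g s True - g s False) * p"
      by (subst Bochner_Integration.integral_add) (auto simp: prob_space prob_retain[OF s])
    finally show "expectation (\<lambda>\<omega>. g s (X s \<omega>)) = p * g s True + (1 - p) * g s False"
      by (simp add: algebra_simps)
  qed
  have "indep_vars (\<lambda>_. borel) (\<lambda>s \<omega>. g s (X s \<omega>)) C"
    by (rule indep_vars_compose2[OF indep_vars_subset[OF indep assms(2)]]) simp
  then show ?thesis
    using assms(1) single by (subst indep_vars_lebesgue_integral) auto
qed

text \<open>By independence the expectation is a product. One factor is
  \<open>1 + p * (exp (l * x s) - 1)\<close>, which \<open>exp_le_linear\<close> and
  \<open>1 + t \<le> exp t\<close> bound by \<open>exp (p * l * (1 + l) * x s)\<close>.\<close>

lemma expectation_exp_coins_le: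
  fixes l :: real and x :: "nat \<times> nat \<times> nat \<Rightarrow> real"
  assumes "finite C" "C \<subseteq> square_indices M" "M \<ge> 1" "0 \<le> l" "l \<le> 1"
    and "\<And>s. s \<in> C \<Longrightarrow> 0 \<le> x s \<and> x s \<le> 1"
  shows "expectation (\<lambda>\<omega>. exp (l * (\<Sum>s\<in>C. x s * of_bool (X s \<omega>)))) \<le> exp (p * l * (1 + l) * sum x C)"
proof -
  have "exp (l * (\<Sum>s\<in>C. x s * of_bool (X s \<omega>))) = (\<Prod>s\<in>C. exp (l * x s * of_bool (X s \<omega>)))" for \<omega>
    unfolding sum_distrib_left exp_sum[OF assms(1)] by (simp add: mult.assoc)
  then have "expectation (\<lambda>\<omega>. exp (l * (\<Sum>s\<in>C. x s * of_bool (X s \<omega>))))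
      = (\<Prod>s\<in>C. p * exp (l * x s) + (1 - p))"
    using expectation_prod_coins[OF assms(1,2), of "\<lambda>s b. exp (l * x s * of_bool b)"] by simp
  also have "\<dots> \<le> (\<Prod>s\<in>C. exp (p * l * (1 + l) * x s))"
  proof (rule prod_mono, intro conjI)
    fix s assume "s \<in> C"
    show "0 \<le> p * exp (l * x s) + (1 - p)"
      using p_bounds[OF \<open>M \<ge> 1\<close>] by simp
    have "p * (exp (l * x s) - 1) \<le> p * (l * x s * (1 + l))"
      using \<open>s \<in> C\<close> assms p_bounds[OF \<open>M \<ge> 1\<close>] by (intro mult_left_mono exp_le_linear) auto
    moreover have "1 + p * (l * x s * (1 + l)) \<le> exp (p * (l * x s * (1 + l)))"
      by (rule exp_ge_add_one_self)
    moreover have "p * (l * x s * (1 + l)) = p * l * (1 + l) * x s"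
      by simp
    ultimately show "p * exp (l * x s) + (1 - p) \<le> exp (p * l * (1 + l) * x s)"
      by (simp only: right_diff_distrib mult_1_right)
  qed
  also have "\<dots> = exp (p * l * (1 + l) * sum x C)"
    by (simp add: sum_distrib_left exp_sum assms(1))
  finally show ?thesis .
qed

text \<open>The retained set of level \<open>n\<close> depends on coins of levels at most
  \<open>n\<close> only, and these are disjoint from \<open>C\<close>.\<close>

lemma indep_var_retained_next_level:
  assumes "M \<ge> 1" "finite C" "C \<subseteq> square_indices M" "\<And>s. s \<in> C \<Longrightarrow> fst s = Suc n"
  shows "indep_var borel (\<lambda>\<omega>. f (retained_indices M X \<omega> n) :: real)
    borel (\<lambda>\<omega>. g (restrict (\<lambda>s. X s \<omega>) C) :: real)"
proof -
  have "{s \<in> square_indices M. fst s \<le> n} \<inter> C = {}"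
    using assms(4) by fastforce
  then show ?thesis
    unfolding retained_indices_eq_restrict[OF assms(1)]
    using assms(2,3) finite_square_indices_upto[of n]
    by (intro indep_var_finite_coins[where f = "\<lambda>c. f (retained_indices M (\<lambda>s c. c s) c n)"]) auto
qed

lemma integrable_retained_indices:
  assumes "M \<ge> 1"
  shows "integrable P (\<lambda>\<omega>. f (retained_indices M X \<omega> n) :: real)"
proof (rule integrable_const_bound)
  let ?D = "Pow ({..<M ^ n} \<times> {..<M ^ n})"
  \<comment> \<open>The retained set takes values in the finite set \<open>?D\<close>, so the sum of
    all possible norms is a constant bound.\<close>
  show "AE \<omega> in P. norm (f (retained_indices M X \<omega> n)) \<le> (\<Sum>S\<in>?D. norm (f S))"
    by (intro AE_I2 member_le_sum[of _ ?D "\<lambda>S. norm (f S)"] retained_indices_in_Pow[OF assms]) auto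
  show "(\<lambda>\<omega>. f (retained_indices M X \<omega> n)) \<in> borel_measurable P"
    using measurable_compose[OF measurable_retained_indices[OF assms], of f borel] by simp
qed

section \<open>The supermartingale step\<close>

text \<open>Given the retained set \<open>S\<close> of level \<open>n\<close>, the fresh coins yield
  an expectation of at most \<open>exp (p * l * (1 + l) * M * sum x S)\<close>, and
  \<open>M * p * (1 + l) \<le> 1\<close> brings the exponent down to \<open>l * sum x S\<close>.
  Conditioning is replaced by a finite sum over all possible \<open>S\<close>.\<close>

lemma exp_potential_step:
  fixes x y :: "nat \<times> nat \<Rightarrow> real" and l :: real
  assumes "M \<ge> 1" "0 \<le> l" "l \<le> 1" "real M * p * (1 + l) \<le> 1"
    and x: "\<And>Q. 0 \<le> x Q" and y: "\<And>Q. 0 \<le> y Q \<and> y Q \<le> 1"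
    and children: "\<And>Q. sum y (children M {Q}) = M * x Q"
  shows "expectation (\<lambda>\<omega>. exp (l * sum y (retained_indices M X \<omega> (Suc n))))
    \<le> expectation (\<lambda>\<omega>. exp (l * sum x (retained_indices M X \<omega> n)))"
proof -
  define R where "R = (\<lambda>\<omega>. retained_indices M X \<omega> n)"
  define D where "D = Pow ({..<M ^ n} \<times> {..<M ^ n})"
  \<comment> \<open>\<open>C S\<close> consists of the coins tossed at level \<open>Suc n\<close>
    when \<open>S\<close> is the retained set of level \<open>n\<close>, and \<open>Z S\<close> is
    the exponential that results in that case. \<open>Z S\<close> is defined at every sample point,
    so it can be independent of the event \<open>R \<omega> = S\<close>.\<close>
  define C where "C = (\<lambda>S. Pair (Suc n) ` children M S)"
  define Z where "Z = (\<lambda>S \<omega>. exp (l * (\<Sum>s\<in>C S. y (snd s) * of_bool (X s \<omega>))))"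
  have RD: "R \<omega> \<in> D" for \<omega>
    unfolding R_def D_def by (rule retained_indices_in_Pow[OF assms(1)])
  have "finite D" by (simp add: D_def)
  have finS: "finite S" if "S \<in> D" for S
    using that by (auto simp: D_def intro: finite_subset)
  have finC: "finite (C S)" and subC: "C S \<subseteq> square_indices M" if "S \<in> D" for S
  proof -
    show "finite (C S)"
      using finS[OF that] assms(1) by (simp add: C_def finite_children)
    show "C S \<subseteq> square_indices M"
      using that assms(1)
      by (auto simp: C_def D_def children_def square_indices_def div_less_iff_less_mult mult.commute)
  qed
  have Z_eq: "Z S \<omega> = exp (l * (\<Sum>Q\<in>children M S. y Q * of_bool (X (Suc n, Q) \<omega>)))" for S \<omega>
    unfolding Z_def C_def by (subst sum.reindex) (auto simp: inj_on_def)
  have split: "exp (l * sum y (retained_indices M X \<omega> (Suc n)))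
      = (\<Sum>S\<in>D. of_bool (R \<omega> = S) * Z S \<omega>)" for \<omega>
  proof -
    have "sum y (retained_indices M X \<omega> (Suc n))
        = (\<Sum>Q\<in>children M (R \<omega>). y Q * of_bool (X (Suc n, Q) \<omega>))"
      unfolding retained_indices_Suc sum.inter_filter[OF finite_children[OF finS[OF RD[unfolded R_def]] assms(1)]]
      by (intro sum.cong) (auto simp: R_def)
    then have "exp (l * sum y (retained_indices M X \<omega> (Suc n))) = Z (R \<omega>) \<omega>"
      by (simp add: Z_eq)
    also have "\<dots> = (\<Sum>S\<in>D. if R \<omega> = S then Z S \<omega> else 0)"
      using RD \<open>finite D\<close> by simp
    also have "\<dots> = (\<Sum>S\<in>D. of_bool (R \<omega> = S) * Z S \<omega>)"
      by (intro sum.cong) auto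
    finally show ?thesis .
  qed
  have Z_indep: "indep_var borel (\<lambda>\<omega>. of_bool (R \<omega> = S)) borel (Z S)" if "S \<in> D" for S
  proof -
    have "indep_var borel (\<lambda>\<omega>. of_bool (R \<omega> = S)) borel
        (\<lambda>\<omega>. exp (l * (\<Sum>s\<in>C S. y (snd s) * of_bool (restrict (\<lambda>s. X s \<omega>) (C S) s))))"
      unfolding R_def
      by (rule indep_var_retained_next_level[OF assms(1) finC[OF that] subC[OF that],
            where f = "\<lambda>T. of_bool (T = S)" and
              g = "\<lambda>c. exp (l * (\<Sum>s\<in>C S. y (snd s) * of_bool (c s)))"]) (auto simp: C_def)
    then show ?thesis by (simp add: Z_def cong: sum.cong)
  qed
  have int_R: "integrable P (\<lambda>\<omega>. f (R \<omega>) :: real)" for f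
    unfolding R_def by (rule integrable_retained_indices[OF assms(1)])
  have int_Z: "integrable P (Z S)" if "S \<in> D" for S
  proof (rule integrable_const_bound)
    show "AE \<omega> in P. norm (Z S \<omega>) \<le> exp (l * (\<Sum>s\<in>C S. y (snd s)))"
      using y assms(2) by (auto simp: Z_def intro!: mult_left_mono sum_mono)
    show "Z S \<in> borel_measurable P"
      using Z_indep[OF that] unfolding indep_var_def indep_vars_def by (auto split: bool.splits)
  qed
  have sum_C: "(\<Sum>s\<in>C S. y (snd s)) = M * sum x S" if "S \<in> D" for S
  proof -
    have "(\<Sum>s\<in>C S. y (snd s)) = sum y (children M S)"
      unfolding C_def by (subst sum.reindex) (auto simp: inj_on_def)
    also have "\<dots> = (\<Sum>Q\<in>S. sum y (children M {Q}))"
      by (rule sum_children[OF finS[OF that] assms(1)])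
    finally show ?thesis by (simp add: children sum_distrib_left)
  qed
  have Z_le: "expectation (Z S) \<le> exp (l * sum x S)" if "S \<in> D" for S
  proof -
    have "expectation (Z S) \<le> exp (p * l * (1 + l) * (\<Sum>s\<in>C S. y (snd s)))"
      unfolding Z_def
      using finC[OF that] subC[OF that] y assms(1-3) by (intro expectation_exp_coins_le) auto
    also have "p * l * (1 + l) * (\<Sum>s\<in>C S. y (snd s)) = (real M * p * (1 + l)) * (l * sum x S)"
      by (simp add: sum_C[OF that])
    also have "\<dots> \<le> 1 * (l * sum x S)"
      by (intro mult_right_mono mult_nonneg_nonneg sum_nonneg assms x)
    finally show ?thesis by simp
  qed
  \<comment> \<open>Each summand factors by independence, \<open>Z_le\<close> bounds the second
    factor, and the sum over \<open>S\<close> is then folded back into a function of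
    \<open>R\<close>.\<close>
  have "expectation (\<lambda>\<omega>. exp (l * sum y (retained_indices M X \<omega> (Suc n))))
      = (\<Sum>S\<in>D. expectation (\<lambda>\<omega>. of_bool (R \<omega> = S) * Z S \<omega>))"
    unfolding split
    by (rule Bochner_Integration.integral_sum)
       (rule indep_var_integrable[OF Z_indep int_R[of "\<lambda>T. of_bool (T = _)"] int_Z])
  also have "\<dots> = (\<Sum>S\<in>D. expectation (\<lambda>\<omega>. of_bool (R \<omega> = S)) * expectation (Z S))"
    by (intro sum.cong refl indep_var_lebesgue_integral Z_indep int_Z int_R[of "\<lambda>T. of_bool (T = _)"])
  also have "\<dots> \<le> (\<Sum>S\<in>D. expectation (\<lambda>\<omega>. of_bool (R \<omega> = S)) * exp (l * sum x S))"
    by (intro sum_mono mult_left_mono Z_le integral_nonneg_AE) auto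
  also have "\<dots> = expectation (\<lambda>\<omega>. \<Sum>S\<in>D. of_bool (R \<omega> = S) * exp (l * sum x S))"
    using int_R[of "\<lambda>T. of_bool (T = _)"] by (subst Bochner_Integration.integral_sum) auto
  also have "(\<lambda>\<omega>. \<Sum>S\<in>D. of_bool (R \<omega> = S) * exp (l * sum x S)) = (\<lambda>\<omega>. exp (l * sum x (R \<omega>)))"
    using RD \<open>finite D\<close> by (auto simp: of_bool_def if_distrib[of "\<lambda>u. u * _"] cong: if_cong)
  finally show ?thesis by (simp add: R_def)
qed

end

section \<open>Exponential moments for sets with one cell per column or row\<close>

lemma sum_card_fibres:
  assumes "finite C" "finite G"
  shows "(\<Sum>c\<in>C. card {g \<in> G. h g = c}) = card {g \<in> G. h g \<in> C}"
proof -
  have "{g \<in> G. h g \<in> C} = (\<Union>c\<in>C. {g \<in> G. h g = c})" by auto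
  with assms show ?thesis
    by (simp, subst card_UN_disjoint) auto
qed

text \<open>The injective map \<open>h\<close> sends the fibre into a block of \<open>d\<close>
  consecutive numbers.\<close>

lemma card_div_fibre_le:
  fixes h :: "'b \<Rightarrow> nat"
  assumes "inj_on h G" "d \<ge> 1"
  shows "card {g \<in> G. h g div d = i} \<le> d"
proof -
  have "h g < d + i * d" if "h g div d = i" for g
    using that assms(2) dividend_less_div_times[of d "h g"] by auto
  then have "h ` {g \<in> G. h g div d = i} \<subseteq> {i * d..<d + i * d}"
    by auto
  then have "card {g \<in> G. h g div d = i} \<le> card {i * d..<d + i * d}"
    using assms(1) by (intro card_inj_on_le[of h]) (auto intro: inj_on_subset)
  then show ?thesis by simp
qed

context fractal_percolation
begin

lemma expectation_exp_card_graph_le: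
  fixes l :: real
  assumes "M \<ge> 1" "0 \<le> l" "l \<le> 1" "real M * p * (1 + l) \<le> 1"
    and "finite G" "inj_on fst G \<or> inj_on snd G" "G \<subseteq> {..<M ^ N} \<times> {..<M ^ N}"
  shows "expectation (\<lambda>\<omega>. exp (l * card (retained_indices M X \<omega> N \<inter> G))) \<le> exp l"
proof -
  \<comment> \<open>\<open>anc k\<close> is the ancestor \<open>k\<close> levels up.
    \<open>x k\<close> is the weight for squares of level \<open>N - k\<close>: the number of cells
    of \<open>G\<close> below the square, divided by \<open>M ^ k\<close>.\<close>
  define anc where "anc = (\<lambda>k (i, j). (i div M ^ k, j div M ^ k :: nat))"
  define x where "x = (\<lambda>k Q. real (card {g \<in> G. anc k g = Q}) / M ^ k)"
  have x_nonneg: "0 \<le> x k Q" for k Q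
    by (simp add: x_def)
  have x_le: "x k Q \<le> 1" for k Q
  proof -
    obtain i j where Q: "Q = (i, j)" by fastforce
    \<comment> \<open>Cells below \<open>Q\<close> lie in a block of \<open>M ^ k\<close> columns
      and in a block of \<open>M ^ k\<close> rows; the projection that is injective on
      \<open>G\<close> supplies the bound.\<close>
    have "card {g \<in> G. anc k g = Q} \<le> card {g \<in> G. fst g div M ^ k = i}"
         "card {g \<in> G. anc k g = Q} \<le> card {g \<in> G. snd g div M ^ k = j}"
      using assms(5) by (auto simp: anc_def Q intro!: card_mono)
    moreover have "card {g \<in> G. fst g div M ^ k = i} \<le> M ^ k \<or> card {g \<in> G. snd g div M ^ k = j} \<le> M ^ k"
      using assms(1,6) by (auto intro: card_div_fibre_le)
    ultimately have "card {g \<in> G. anc k g = Q} \<le> M ^ k"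
      by linarith
    then have "real (card {g \<in> G. anc k g = Q}) \<le> real M ^ k"
      by (metis of_nat_le_iff of_nat_power)
    then show ?thesis
      using assms(1) by (simp add: x_def divide_le_eq)
  qed
  have children: "sum (x k) (children M {Q}) = M * x (Suc k) Q" for k Q
  proof -
    have "sum (x k) (children M {Q}) = (\<Sum>c\<in>children M {Q}. real (card {g \<in> G. anc k g = c})) / M ^ k"
      by (simp add: x_def sum_divide_distrib)
    also have "(\<Sum>c\<in>children M {Q}. real (card {g \<in> G. anc k g = c})) = card {g \<in> G. anc k g \<in> children M {Q}}"
      using sum_card_fibres[OF finite_children[of "{Q}" M] assms(5), of "anc k"] assms(1)
      by (simp flip: of_nat_sum)
    also have "{g \<in> G. anc k g \<in> children M {Q}} = {g \<in> G. anc (Suc k) g = Q}"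
      by (auto simp: anc_def children_def div_mult2_eq power_Suc2 simp del: power_Suc)
    finally show ?thesis
      using assms(1) by (simp add: x_def)
  qed
  \<comment> \<open>Level \<open>n\<close> carries the weight \<open>x (N - n)\<close>. At level 0
    the only square has weight at most 1, whence the bound \<open>exp l\<close>; at level
    \<open>N\<close> the weight is the indicator of \<open>G\<close>, so the sum counts retained
    cells of \<open>G\<close>.\<close>
  have "expectation (\<lambda>\<omega>. exp (l * sum (x (N - n)) (retained_indices M X \<omega> n))) \<le> exp l" if "n \<le> N" for n
    using that
  proof (induction n)
    case 0
    then show ?case
      using x_le[of N] assms(2) by (simp add: prob_space mult_left_le)
  next
    case (Suc n)
    have "Suc (N - Suc n) = N - n"
      using Suc.prems by simp
    then have "expectation (\<lambda>\<omega>. exp (l * sum (x (N - Suc n)) (retained_indices M X \<omega> (Suc n))))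
        \<le> expectation (\<lambda>\<omega>. exp (l * sum (x (N - n)) (retained_indices M X \<omega> n)))"
      using children[of "N - Suc n"] x_nonneg x_le
      by (intro exp_potential_step assms) auto
    also have "\<dots> \<le> exp l"
      using Suc by simp
    finally show ?case .
  qed
  moreover have "sum (x 0) (retained_indices M X \<omega> N) = card (retained_indices M X \<omega> N \<inter> G)" for \<omega>
  proof -
    have "sum (x 0) (retained_indices M X \<omega> N)
        = real (\<Sum>c\<in>retained_indices M X \<omega> N. card {g \<in> G. anc 0 g = c})"
      by (simp add: x_def)
    also have "\<dots> = card {g \<in> G. anc 0 g \<in> retained_indices M X \<omega> N}"
      by (simp only: sum_card_fibres[OF finite_retained_indices[OF assms(1)] assms(5)])
    also have "{g \<in> G. anc 0 g \<in> retained_indices M X \<omega> N} = retained_indices M X \<omega> N \<inter> G"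
      by (auto simp: anc_def)
    finally show ?thesis .
  qed
  ultimately show ?thesis
    by fastforce
qed

text \<open>Markov's inequality applied to the exponential moment.\<close>

lemma prob_card_graph_ge:
  fixes l :: real
  assumes "M \<ge> 1" "0 \<le> l" "l \<le> 1" "real M * p * (1 + l) \<le> 1"
    and "finite G" "inj_on fst G \<or> inj_on snd G" "G \<subseteq> {..<M ^ N} \<times> {..<M ^ N}"
  shows "prob {\<omega> \<in> space P. u \<le> l * card (retained_indices M X \<omega> N \<inter> G)} \<le> exp (l - u)"
proof -
  have "prob {\<omega> \<in> space P. exp u \<le> exp (l * card (retained_indices M X \<omega> N \<inter> G))}
      \<le> expectation (\<lambda>\<omega>. exp (l * card (retained_indices M X \<omega> N \<inter> G))) / exp u"
    using integrable_retained_indices[OF assms(1), of "\<lambda>S. exp (l * card (S \<inter> G))" N]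
    by (intro integral_Markov_inequality_measure[where A = "space P"]) auto
  also have "\<dots> \<le> exp l / exp u"
    by (intro divide_right_mono expectation_exp_card_graph_le[OF assms]) simp
  finally show ?thesis
    by (simp add: exp_diff)
qed

end

section \<open>Digital lines and the covering of a line\<close>

text \<open>A discretized line of slope \<open>k / m\<close> in an \<open>m\<close> by
  \<open>m\<close> grid, over the columns if \<open>b\<close> holds and over the rows otherwise. The
  intercept \<open>a\<close> counts cells and is an integer because the line may enter the grid from
  below or from the left.\<close>

definition digital_line :: "nat \<Rightarrow> bool \<Rightarrow> int \<Rightarrow> nat \<Rightarrow> (nat \<times> nat) set" where
  "digital_line m b a k =
    {(i, j). i < m \<and> j < m \<and> (if b then int j = a + int (k * i div m) else int i = a + int (k * j div m))}"

lemma digital_line_subset: "digital_line m b a k \<subseteq> {..<m} \<times> {..<m}"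
  by (auto simp: digital_line_def)

lemma finite_digital_line: "finite (digital_line m b a k)"
  by (rule finite_subset[OF digital_line_subset]) simp

lemma inj_on_digital_line: "inj_on fst (digital_line m b a k) \<or> inj_on snd (digital_line m b a k)"
  by (cases b) (auto simp: digital_line_def inj_on_def)

text \<open>The term \<open>k * i div m\<close> lies between 0 and \<open>m\<close>, so a larger
  shift leaves the grid. Only finitely many intercepts thus enter the union bound.\<close>

lemma digital_line_nonempty_imp:
  assumes "digital_line m b a k \<noteq> {}" "k \<le> m"
  shows "- int m \<le> a \<and> a \<le> int m"
proof -
  have "k * i div m \<le> m" if "i < m" for i
  proof -
    have "k * i \<le> m * m" using that assms(2) by (intro mult_mono) auto
    then have "k * i div m \<le> m * m div m" by (rule div_le_mono)
    with that show ?thesis by simp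
  qed
  then have "int (k * i div m) \<le> int m" if "i < m" for i
    using that by (metis of_nat_le_iff)
  with assms(1) show ?thesis
    by (fastforce simp: digital_line_def split: if_splits)
qed

lemma interior_level_square:
  assumes "M \<ge> 1"
  shows "interior (level_square M n (i, j)) =
    {(u, v). real i < u * M ^ n \<and> u * M ^ n < real i + 1 \<and> real j < v * M ^ n \<and> v * M ^ n < real j + 1}"
  using assms
  by (auto simp: level_square_def interior_Times interior_atLeastAtMost_real divide_less_eq less_divide_eq add.commute)

text \<open>Slope and intercept are rounded down to the grid. The total error is nonnegative and
  less than 4 cells, which gives the four offsets \<open>d\<close>.\<close>

lemma digital_line_covers_cell:
  fixes s c u v :: real and m i j :: nat
  assumes "0 \<le> s" "s \<le> 1" "i < m" "v = c + s * u"
    and "real i < u * m" "u * m < real i + 1" "real j < v * m" "v * m < real j + 1"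
  shows "\<exists>d\<in>{0..3}. int j = \<lfloor>c * m\<rfloor> + d + int (nat \<lfloor>s * m\<rfloor> * i div m)"
proof -
  define k where "k = nat \<lfloor>s * m\<rfloor>"
  define a where "a = \<lfloor>c * m\<rfloor>"
  define q where "q = int (k * i div m)"
  have k: "real k \<le> s * m" "s * m < real k + 1"
    using assms(1) by (auto simp: k_def)
  have a: "of_int a \<le> c * m" "c * m < of_int a + 1"
    by (auto simp: a_def)
  have q_floor: "q = \<lfloor>real (k * i) / real m\<rfloor>"
    unfolding q_def by (simp only: floor_divide_of_nat_eq)
  have q: "of_int q \<le> real k * i / m" "real k * i / m < of_int q + 1"
    unfolding q_floor by auto
  have v: "v * m = c * m + s * (u * m)"
    using assms(4) by (simp add: algebra_simps)
  have "0 < m" using assms(3) by simp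
  have lower: "real k * i / m \<le> s * (u * m)"
  proof -
    have "real k * i / m \<le> (s * m) * i / m"
      using k by (intro divide_right_mono mult_right_mono) auto
    also have "\<dots> = s * i" using \<open>0 < m\<close> by simp
    also have "\<dots> \<le> s * (u * m)" using assms by (intro mult_left_mono) auto
    finally show ?thesis .
  qed
  \<comment> \<open>The position inside the column costs at most 1, and rounding the slope costs at
    most \<open>i / m\<close>, again at most 1.\<close>
  have upper: "s * (u * m) \<le> real k * i / m + 2"
  proof -
    have "s * (u * m) \<le> s * (real i + 1)" using assms by (intro mult_left_mono) auto
    also have "\<dots> \<le> s * i + 1" using assms by (simp add: algebra_simps)
    also have "s * i = (s * m) * i / m" using \<open>0 < m\<close> by simp
    also have "\<dots> \<le> (real k + 1) * i / m"
      using k by (intro divide_right_mono mult_right_mono) auto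
    also have "\<dots> = real k * i / m + real i / m" by (simp add: add_divide_distrib distrib_right)
    also have "real i / m \<le> 1" using assms(3) by simp
    finally show ?thesis by simp
  qed
  have "of_int (a + q) < real j + 1"
    using a q lower v assms(8) by simp
  then have "a + q \<le> int j" by linarith
  \<comment> \<open>To the 2 from \<open>upper\<close>, the floors defining \<open>a\<close> and
    \<open>q\<close> add less than 1 each.\<close>
  moreover have "real j < of_int (a + q + 4)"
    using a q upper v assms(7) by simp
  then have "int j < a + q + 4" by linarith
  ultimately show ?thesis
    unfolding q_def[symmetric] k_def[symmetric] a_def[symmetric]
    by (intro bexI[of _ "int j - a - q"]) auto
qed

text \<open>Using the horizontal coordinate as variable if
  \<open>sin \<alpha> \<le> cos \<alpha>\<close> and the vertical one otherwise keeps the slope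
  \<open>s\<close> in the unit interval, as \<open>digital_line_covers_cell\<close>
  requires.\<close>

lemma line_covered_by_digital_lines:
  assumes "line_with_angle L \<alpha>" "0 < \<alpha>" "\<alpha> < pi / 2" "M \<ge> 1"
  obtains b a k where "k \<le> M ^ n"
    "{(i, j). i < M ^ n \<and> j < M ^ n \<and> interior (level_square M n (i, j)) \<inter> L \<noteq> {}}
      \<subseteq> (\<Union>d\<in>{0..3}. digital_line (M ^ n) b (a + d) k)"
proof -
  obtain x y where L: "L = range (\<lambda>t::real. (x, y) + t *\<^sub>R (cos \<alpha>, sin \<alpha>))"
    using assms(1) by (auto simp: line_with_angle_def)
  have pos: "0 < cos \<alpha>" "0 < sin \<alpha>"
    using assms(2,3) by (auto simp: cos_gt_zero sin_gt_zero2)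
  let ?m = "M ^ n"
  have slope_k: "nat \<lfloor>s * real ?m\<rfloor> \<le> ?m" if "0 \<le> s" "s \<le> 1" for s :: real
  proof -
    have "\<lfloor>s * real ?m\<rfloor> \<le> int ?m"
      using that by (simp add: floor_le_iff) (smt (verit) mult_left_le_one_le of_nat_0_le_iff of_nat_power)
    then show ?thesis by (simp only: nat_le_iff)
  qed
  show thesis
  proof (cases "sin \<alpha> \<le> cos \<alpha>")
    case True
    define s where "s = sin \<alpha> / cos \<alpha>"
    have s: "0 \<le> s" "s \<le> 1" using True pos by (auto simp: s_def)
    define c where "c = y - s * x"
    have on_line: "v = c + s * u" if "(u, v) \<in> L" for u v
      using that pos by (auto simp: L c_def s_def field_simps)
    show thesis
    proof (rule that[of "nat \<lfloor>s * ?m\<rfloor>" True "\<lfloor>c * ?m\<rfloor>"])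
      show "nat \<lfloor>s * real ?m\<rfloor> \<le> ?m" by (rule slope_k[OF s])
      show "{(i, j). i < ?m \<and> j < ?m \<and> interior (level_square M n (i, j)) \<inter> L \<noteq> {}}
          \<subseteq> (\<Union>d\<in>{0..3}. digital_line ?m True (\<lfloor>c * ?m\<rfloor> + d) (nat \<lfloor>s * ?m\<rfloor>))"
      proof (rule subsetI)
        fix Q
        assume "Q \<in> {(i, j). i < ?m \<and> j < ?m \<and> interior (level_square M n (i, j)) \<inter> L \<noteq> {}}"
        then obtain i j u v where Q: "Q = (i, j)" and ij: "i < ?m" "j < ?m"
            and uv: "(u, v) \<in> interior (level_square M n (i, j))" "(u, v) \<in> L"
          by auto
        have "\<exists>d\<in>{0..3}. int j = \<lfloor>c * ?m\<rfloor> + d + int (nat \<lfloor>s * ?m\<rfloor> * i div ?m)"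
          using uv(1) on_line[OF uv(2)] ij s
          by (intro digital_line_covers_cell[of s i ?m v c u j]) (auto simp: interior_level_square[OF assms(4)])
        then show "Q \<in> (\<Union>d\<in>{0..3}. digital_line ?m True (\<lfloor>c * ?m\<rfloor> + d) (nat \<lfloor>s * ?m\<rfloor>))"
          using ij by (auto simp: digital_line_def Q)
      qed
    qed
  next
    case False
    define s where "s = cos \<alpha> / sin \<alpha>"
    have s: "0 \<le> s" "s \<le> 1" using False pos by (auto simp: s_def)
    define c where "c = x - s * y"
    have on_line: "u = c + s * v" if "(u, v) \<in> L" for u v
      using that pos by (auto simp: L c_def s_def field_simps)
    show thesis
    proof (rule that[of "nat \<lfloor>s * ?m\<rfloor>" False "\<lfloor>c * ?m\<rfloor>"])
      show "nat \<lfloor>s * real ?m\<rfloor> \<le> ?m" by (rule slope_k[OF s])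
      show "{(i, j). i < ?m \<and> j < ?m \<and> interior (level_square M n (i, j)) \<inter> L \<noteq> {}}
          \<subseteq> (\<Union>d\<in>{0..3}. digital_line ?m False (\<lfloor>c * ?m\<rfloor> + d) (nat \<lfloor>s * ?m\<rfloor>))"
      proof (rule subsetI)
        fix Q
        assume "Q \<in> {(i, j). i < ?m \<and> j < ?m \<and> interior (level_square M n (i, j)) \<inter> L \<noteq> {}}"
        then obtain i j u v where Q: "Q = (i, j)" and ij: "i < ?m" "j < ?m"
            and uv: "(u, v) \<in> interior (level_square M n (i, j))" "(u, v) \<in> L"
          by auto
        have "\<exists>d\<in>{0..3}. int i = \<lfloor>c * ?m\<rfloor> + d + int (nat \<lfloor>s * ?m\<rfloor> * j div ?m)"
          using uv(1) on_line[OF uv(2)] ij s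
          by (intro digital_line_covers_cell[of s j ?m u c v i]) (auto simp: interior_level_square[OF assms(4)])
        then show "Q \<in> (\<Union>d\<in>{0..3}. digital_line ?m False (\<lfloor>c * ?m\<rfloor> + d) (nat \<lfloor>s * ?m\<rfloor>))"
          using ij by (auto simp: digital_line_def Q)
      qed
    qed
  qed
qed

section \<open>Union bound and Borel-Cantelli\<close>

lemma (in fractal_percolation) AE_card_digital_line_le:
  fixes l :: real
  assumes "M \<ge> 2" "0 < l" "l \<le> 1" "real M * p * (1 + l) \<le> 1"
  shows "AE \<omega> in P. \<forall>\<^sub>F n in sequentially. \<forall>b a. \<forall>k\<le>M ^ n.
    l * card (retained_indices M X \<omega> n \<inter> digital_line (M ^ n) b a k) \<le> 3 * ln M * n"
proof -
  \<comment> \<open>\<open>F n\<close> contains the parameters of all nonempty digital lines with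
    \<open>k \<le> M ^ n\<close>, and \<open>E n\<close> is the bad event for one of them. There are
    at most \<open>12 * M ^ (2 * n)\<close> parameters; the factor 3 in the threshold makes each bad
    event have probability at most \<open>exp l / M ^ (3 * n)\<close>, so that a summable
    \<open>M ^ n\<close> in the denominator survives.\<close>
  define F where "F = (\<lambda>n. (UNIV :: bool set) \<times> {- int (M ^ n)..int (M ^ n)} \<times> {..M ^ n})"
  define E where "E = (\<lambda>n (b, a, k). {\<omega> \<in> space P.
    3 * ln M * n \<le> l * card (retained_indices M X \<omega> n \<inter> digital_line (M ^ n) b a k)})"
  have M1: "M \<ge> 1" using assms(1) by simp
  have finF: "finite (F n)" for n by (simp add: F_def)
  have E_sets: "E n t \<in> events" for n t
  proof (cases t)
    case (fields b a k)
    have "(\<lambda>\<omega>. l * card (retained_indices M X \<omega> n \<inter> digital_line (M ^ n) b a k)) \<in> borel_measurable P"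
      by (rule borel_measurable_integrable[OF integrable_retained_indices[OF M1,
            where f = "\<lambda>S. l * card (S \<inter> digital_line (M ^ n) b a k)"]])
    then show ?thesis
      unfolding fields E_def by simp measurable
  qed
  have prob_E: "prob (E n t) \<le> exp l * (1 / M) ^ (3 * n)" for n t
  proof -
    have "prob (E n t) \<le> exp (l - 3 * ln M * n)"
      using assms(2,3,4) M1 unfolding E_def
      by (cases t, simp) (intro prob_card_graph_ge finite_digital_line digital_line_subset inj_on_digital_line, auto)
    also have "\<dots> = exp l * exp (- ln M) ^ (3 * n)"
      unfolding exp_of_nat_mult[symmetric] exp_add[symmetric] by simp
    also have "exp (- ln M) = 1 / M"
      using M1 by (simp add: exp_minus field_simps)
    finally show ?thesis .
  qed
  have prob_UN: "prob (\<Union>t\<in>F n. E n t) \<le> 12 * exp l * (1 / M) ^ n" for n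
  proof -
    have m: "1 \<le> real M ^ n" using M1 by simp
    have "prob (\<Union>t\<in>F n. E n t) \<le> (\<Sum>t\<in>F n. prob (E n t))"
      using E_sets finF by (intro finite_measure_subadditive_finite) auto
    also have "\<dots> \<le> card (F n) * (exp l * (1 / M) ^ (3 * n))"
      using sum_bounded_above[of "F n" "\<lambda>t. prob (E n t)"] prob_E by simp
    also have "real (card (F n)) = 2 * (2 * real M ^ n + 1) * (real M ^ n + 1)"
      by (simp add: F_def card_cartesian_product nat_add_distrib nat_mult_distrib algebra_simps nat_power_eq)
    also have "\<dots> \<le> 2 * (3 * real M ^ n) * (2 * real M ^ n)"
      using m by (intro mult_mono) auto
    also have "2 * (3 * real M ^ n) * (2 * real M ^ n) * (exp l * (1 / M) ^ (3 * n))
        = 12 * exp l * (1 / M) ^ n"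
      using M1 by (simp add: field_simps power_mult power3_eq_cube flip: power_mult_distrib)
    finally show ?thesis
      by (simp add: mult_right_mono)
  qed
  have "summable (\<lambda>n. prob (\<Union>t\<in>F n. E n t))"
  proof (rule summable_comparison_test')
    show "summable (\<lambda>n. 12 * exp l * (1 / real M) ^ n)"
      using assms(1) by (intro summable_mult summable_geometric) simp
  qed (use prob_UN in auto)
  then have "AE \<omega> in P. \<forall>\<^sub>F n in sequentially. \<omega> \<in> space P - (\<Union>t\<in>F n. E n t)"
    using E_sets finF by (intro borel_cantelli_AE1) (auto simp: emeasure_eq_measure)
  then show ?thesis
  proof (rule AE_mp[OF _ AE_I2], intro impI, elim eventually_mono)
    fix \<omega> n
    assume \<omega>: "\<omega> \<in> space P - (\<Union>t\<in>F n. E n t)"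
    show "\<forall>b a. \<forall>k\<le>M ^ n. l * card (retained_indices M X \<omega> n \<inter> digital_line (M ^ n) b a k) \<le> 3 * ln M * n"
    proof (intro allI impI)
      fix b a k assume k: "k \<le> M ^ n"
      show "l * card (retained_indices M X \<omega> n \<inter> digital_line (M ^ n) b a k) \<le> 3 * ln M * n"
      \<comment> \<open>An empty digital line satisfies the bound trivially; every other one is
        indexed by \<open>F n\<close>.\<close>
      proof (cases "digital_line (M ^ n) b a k = {}")
        case True
        then show ?thesis using M1 by simp
      next
        case False
        then have "(b, a, k) \<in> F n"
          using digital_line_nonempty_imp[OF False k] k by (simp add: F_def)
        with \<omega> show ?thesis by (auto simp: E_def)
      qed
    qed
  qed
qed

section \<open>The bound for segments\<close>

text \<open>The squares counted are images under \<open>level_square M n\<close> of retained indices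
  on the four covering digital lines, and passing to an image does not increase cardinality.\<close>

lemma card_retained_squares_meeting_le:
  assumes "M \<ge> 1" "l \<in> segments"
  obtains b a k where "k \<le> M ^ n"
    "card (retained_squares_meeting M X \<omega> n l)
      \<le> (\<Sum>d\<in>{0..3}. card (retained_indices M X \<omega> n \<inter> digital_line (M ^ n) b (a + d) k))"
proof -
  obtain L \<alpha> where L: "line_with_angle L \<alpha>" "0 < \<alpha>" "\<alpha> < pi / 2" "l = unit_square \<inter> L"
    using assms(2) by (auto simp: segments_def diagonal_line_def)
  obtain b a k where k: "k \<le> M ^ n" and cover:
    "{(i, j). i < M ^ n \<and> j < M ^ n \<and> interior (level_square M n (i, j)) \<inter> L \<noteq> {}}
      \<subseteq> (\<Union>d\<in>{0..3}. digital_line (M ^ n) b (a + d) k)"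
    using line_covered_by_digital_lines[OF L(1-3) assms(1)] .
  let ?S = "\<Union>d\<in>{0..3}. retained_indices M X \<omega> n \<inter> digital_line (M ^ n) b (a + d) k"
  have "retained_squares_meeting M X \<omega> n l \<subseteq> level_square M n ` ?S"
  proof
    fix Q assume "Q \<in> retained_squares_meeting M X \<omega> n l"
    then obtain i j where ij: "(i, j) \<in> retained_indices M X \<omega> n" "Q = level_square M n (i, j)"
        "interior Q \<inter> l \<noteq> {}"
      by (auto simp: retained_squares_meeting_def retained_squares_def)
    then have "(i, j) \<in> (\<Union>d\<in>{0..3}. digital_line (M ^ n) b (a + d) k)"
      using retained_indices_bound[OF assms(1) ij(1)] L(4) by (intro subsetD[OF cover]) auto
    with ij show "Q \<in> level_square M n ` ?S" by auto
  qed
  moreover have "finite ?S"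
    using finite_retained_indices[OF assms(1), of X \<omega> n] by simp
  ultimately have "card (retained_squares_meeting M X \<omega> n l) \<le> card ?S"
    by (meson card_image_le card_mono finite_imageI le_trans)
  also have "\<dots> \<le> (\<Sum>d\<in>{0..3}. card (retained_indices M X \<omega> n \<inter> digital_line (M ^ n) b (a + d) k))"
    by (rule card_UN_le) simp
  finally show thesis by (rule that[OF k])
qed

theorem corollary9:
  fixes P :: "'a measure" and M :: nat and p \<epsilon> r C\<^sub>2 :: real
    and X :: "nat \<times> nat \<times> nat \<Rightarrow> 'a \<Rightarrow> bool"
  assumes "fractal_percolation P M p X"
    and "M \<ge> 2"
    and "1 / real M ^ 2 < p" and "p < 1 / real M"
    and "0 < \<epsilon>" and "\<epsilon> < min p (1 / 10)"
    and "real M * p * (1 + \<epsilon>) < 1"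
    and "r = sqrt 2 * p ^ 2 * \<epsilon> ^ 2 / 9"
    and "C\<^sub>2 = 8 * real M * ln (real M) / r + 1"
  shows "AE \<omega> in P. \<forall>\<theta>\<in>{0<..<pi / 4}. \<exists>N. \<forall>n\<ge>N. \<forall>l\<in>segments_above \<theta>.
    real (card (retained_squares_meeting M X \<omega> n l)) \<le> 6 * C\<^sub>2 * real n"
proof -
  interpret fractal_percolation P M p X by fact
  have M1: "M \<ge> 1" using assms(2) by simp
  have p: "0 < p" "p \<le> 1" using assms(5,6) p_bounds[OF M1] by auto
  have r: "0 < r" "r \<le> \<epsilon>"
  proof -
    show "0 < r" unfolding assms(8) using p assms(5) by simp
    have "sqrt 2 \<le> 2" by (simp add: real_le_lsqrt)
    moreover have "p\<^sup>2 \<le> 1" using p by (simp add: power_le_one)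
    moreover have "\<epsilon>\<^sup>2 \<le> \<epsilon>" using assms(5,6) by (simp add: power2_eq_square mult_left_le)
    ultimately have "sqrt 2 * p\<^sup>2 * \<epsilon>\<^sup>2 \<le> 2 * 1 * \<epsilon>"
      using assms(5) by (intro mult_mono) auto
    then show "r \<le> \<epsilon>" using assms(5,8) by simp
  qed
  \<comment> \<open>Four digital lines with at most \<open>3 * ln M * n / \<epsilon>\<close>
    retained cells each give \<open>12 * ln M / \<epsilon>\<close> per level. The main term of
    \<open>6 * C\<^sub>2\<close> is \<open>48 * M * ln M / r\<close>, which is larger since
    \<open>r \<le> \<epsilon>\<close>.\<close>
  have C2: "12 * ln M / \<epsilon> \<le> 6 * C\<^sub>2"
  proof -
    have "12 * ln M / \<epsilon> \<le> 48 * real M * ln M / r"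
      using assms(2) r by (intro frac_le mult_right_mono) auto
    also have "\<dots> \<le> 6 * C\<^sub>2" by (simp add: assms(9))
    finally show ?thesis .
  qed
  have "AE \<omega> in P. \<forall>\<^sub>F n in sequentially. \<forall>b a. \<forall>k\<le>M ^ n.
      \<epsilon> * card (retained_indices M X \<omega> n \<inter> digital_line (M ^ n) b a k) \<le> 3 * ln M * n"
    using assms(2,5-7) by (intro AE_card_digital_line_le) auto
  then show ?thesis
  proof (rule AE_mp[OF _ AE_I2], intro impI ballI)
    fix \<omega> \<theta>
    assume "\<forall>\<^sub>F n in sequentially. \<forall>b a. \<forall>k\<le>M ^ n.
      \<epsilon> * card (retained_indices M X \<omega> n \<inter> digital_line (M ^ n) b a k) \<le> 3 * ln M * n"
    then obtain N where N: "\<forall>n\<ge>N. \<forall>b a. \<forall>k\<le>M ^ n.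
        \<epsilon> * card (retained_indices M X \<omega> n \<inter> digital_line (M ^ n) b a k) \<le> 3 * ln M * n"
      unfolding eventually_sequentially ..
    show "\<exists>N. \<forall>n\<ge>N. \<forall>l\<in>segments_above \<theta>.
        real (card (retained_squares_meeting M X \<omega> n l)) \<le> 6 * C\<^sub>2 * real n"
    proof (intro exI[of _ N] allI impI ballI)
      fix n l assume n: "n \<ge> N" and "l \<in> segments_above \<theta>"
      then have l: "l \<in> segments" by (simp add: segments_above_def)
      obtain b a k where k: "k \<le> M ^ n" and
        le: "card (retained_squares_meeting M X \<omega> n l)
          \<le> (\<Sum>d\<in>{0..3}. card (retained_indices M X \<omega> n \<inter> digital_line (M ^ n) b (a + d) k))"
        using card_retained_squares_meeting_le[OF M1 l] .
      have bound: "card (retained_indices M X \<omega> n \<inter> digital_line (M ^ n) b a' k) \<le> 3 * ln M * n / \<epsilon>" for a'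
        using N[rule_format, OF n k, of b a'] assms(5) by (simp add: pos_le_divide_eq mult.commute[of \<epsilon>])
      have "real (card (retained_squares_meeting M X \<omega> n l))
          \<le> (\<Sum>d\<in>{0..3}. real (card (retained_indices M X \<omega> n \<inter> digital_line (M ^ n) b (a + d) k)))"
        using le by (simp flip: of_nat_sum)
      also have "\<dots> \<le> (\<Sum>d\<in>{0..3::int}. 3 * ln M * n / \<epsilon>)"
        by (intro sum_mono bound)
      also have "\<dots> = 12 * ln M / \<epsilon> * n" by simp
      also have "\<dots> \<le> 6 * C\<^sub>2 * n"
        using C2 by (intro mult_right_mono) auto
      finally show "real (card (retained_squares_meeting M X \<omega> n l)) \<le> 6 * C\<^sub>2 * real n" .
    qed
  qed
qed

end
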